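(* Let $(M_1,\dots,M_p,Y)$ be a centered process with finite variance on $D\subset\mathbb{R}^d$, with $K_M(x)=\mathrm{Cov}[M(x),M(x)]$ invertible for all $x\in D$, where $M(x)=(M_1(x),\dots,M_p(x))^t$. Let $X$ be the matrix of observation points $x_1,\dots,x_n\in D$. Assume: (linearity) for all $x\in D$ there is a deterministic $p\times n$ matrix $\Lambda(x)$ with $M(x)=\Lambda(x)Y(X)$; (interpolation) for every observation point $x_k$ there is at least one index $i_k\in\{1,\dots,p\}$ with $M_{i_k}(x_k)=Y(x_k)$. With the notation of the context, for all $x\in D$: $$\mathrm{E}\big[(M_{\mathcal{A}}(x)-M_{full}(x))^2\big]=\|k(X,x)-k_{\mathcal{A}}(X,x)\|_K^2,\qquad v_{\mathcal{A}}(x)-v_{full}(x)=\|k(X,x)\|_K^2-\|k_{\mathcal{A}}(X,x)\|_K^2.$$ The absolute differences can be bounded: $$|M_{\mathcal{A}}(x)-M_{full}(x)|\le\|k(X,x)-k_{\mathcal{A}}(X,x)\|_K\,\|Y(X)\|_K,\qquad |v_{\mathcal{A}}(x)-v_{full}(x)|\le\|k(X,x)\|_K^2,$$ where $\|u\|_K^2=u^tk(X,X)^{-1}u$ for $u\in\mathbb{R}^n$. Assuming that the smallest eigenvalue $\lambda_{\min}$ of $k(X,X)$ is non zero, $\|u\|_K^2\le\frac{1}{\lambda_{\min}}\|u\|^2$, where $\|u\|$ is the Euclidean norm. Furthermore, $$0\le v_{\mathcal{A}}(x)-v_{full}(x)\le\min_{j\in\{1,\dots,p\}}\mathrm{E}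\big[(Y(x)-M_j(x))^2\big]-v_{full}(x).$$
   Context: $k(x,x')=\mathrm{Cov}[Y(x),Y(x')]$; for a function $g$ of two variables, $g(X,X)$ is the $n\times n$ matrix with entries $g(x_i,x_j)$, $g(x,X)$ the row vector with entries $g(x,x_j)$ and $g(X,x)$ the column vector with entries $g(x_i,x)$; $Y(X)=(Y(x_1),\dots,Y(x_n))^t$. The matrix $k(X,X)$ is assumed invertible. The full model is $M_{full}(x)=k(x,X)k(X,X)^{-1}Y(X)$ and $v_{full}(x)=k(x,x)-k(x,X)k(X,X)^{-1}k(X,x)=\mathrm{E}[(Y(x)-M_{full}(x))^2]$. With $k_M(x)$ the vector with entries $\mathrm{Cov}[M_i(x),Y(x)]$, the nested Kriging predictor is $M_{\mathcal{A}}(x)=k_M(x)^tK_M(x)^{-1}M(x)$ and $v_{\mathcal{A}}(x)=\mathrm{E}[(Y(x)-M_{\mathcal{A}}(x))^2]=k(x,x)-k_M(x)^tK_M(x)^{-1}k_M(x)$. The aggregated process is $Y_{\mathcal{A}}=M_{\mathcal{A}}+\varepsilon'_{\mathcal{A}}$, where $\varepsilon'_{\mathcal{A}}$ is an independent replicate of $Y-M_{\mathcal{A}}$ (a process with the same distribution as $Y-M_{\mathcal{A}}$, independent of $(M_1,\dots,M_p,Y)$), and $k_{\mathcal{A}}(x,x')=\mathrm{Cov}[Y_{\mathcal{A}}(x),Y_{\mathcal{A}}(x')]$. Relations between random variables hold almost surely. *)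

theory Defs
  imports "HOL-Probability.Probability"
begin

definition cov :: "'w measure \<Rightarrow> ('w \<Rightarrow> real) \<Rightarrow> ('w \<Rightarrow> real) \<Rightarrow> real" where
  "cov P U V = (\<integral>\<omega>. (U \<omega> - (\<integral>\<omega>'. U \<omega>' \<partial>P)) * (V \<omega> - (\<integral>\<omega>'. V \<omega>' \<partial>P)) \<partial>P)"

text \<open>The matrix $g(X,X)$, the row $g(x,X)$ and the column $g(X,x)$; the observation points
  are the rows of \<open>X\<close>.\<close>

definition gmat :: "('d \<Rightarrow> 'd \<Rightarrow> real) \<Rightarrow> 'd ^ 'n \<Rightarrow> real ^ 'n ^ 'n" where
  "gmat g X = (\<chi> i j. g (X $ i) (X $ j))"

definition grow :: "('d \<Rightarrow> 'd \<Rightarrow> real) \<Rightarrow> 'd \<Rightarrow> 'd ^ 'n \<Rightarrow> real ^ 'n" where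
  "grow g x X = (\<chi> j. g x (X $ j))"

definition gcol :: "('d \<Rightarrow> 'd \<Rightarrow> real) \<Rightarrow> 'd ^ 'n \<Rightarrow> 'd \<Rightarrow> real ^ 'n" where
  "gcol g X x = (\<chi> i. g (X $ i) x)"

definition obs :: "('d \<Rightarrow> 'w \<Rightarrow> real) \<Rightarrow> 'd ^ 'n \<Rightarrow> 'w \<Rightarrow> real ^ 'n" where
  "obs Y X \<omega> = (\<chi> i. Y (X $ i) \<omega>)"

definition cov_kernel :: "'w measure \<Rightarrow> ('d \<Rightarrow> 'w \<Rightarrow> real) \<Rightarrow> 'd \<Rightarrow> 'd \<Rightarrow> real" where
  "cov_kernel P Y x x' = cov P (Y x) (Y x')"

definition M_full ::
  "'w measure \<Rightarrow> ('d \<Rightarrow> 'w \<Rightarrow> real) \<Rightarrow> 'd ^ ('n::finite) \<Rightarrow> 'd \<Rightarrow> 'w \<Rightarrow> real" where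
  "M_full P Y X x \<omega> =
     grow (cov_kernel P Y) x X \<bullet> (matrix_inv (gmat (cov_kernel P Y) X) *v obs Y X \<omega>)"

definition v_full ::
  "'w measure \<Rightarrow> ('d \<Rightarrow> 'w \<Rightarrow> real) \<Rightarrow> 'd ^ ('n::finite) \<Rightarrow> 'd \<Rightarrow> real" where
  "v_full P Y X x = cov_kernel P Y x x -
     grow (cov_kernel P Y) x X \<bullet> (matrix_inv (gmat (cov_kernel P Y) X) *v gcol (cov_kernel P Y) X x)"

definition K_M ::
  "'w measure \<Rightarrow> ('d \<Rightarrow> 'w \<Rightarrow> real ^ 'p) \<Rightarrow> 'd \<Rightarrow> real ^ 'p ^ 'p" where
  "K_M P M x = (\<chi> i j. cov P (\<lambda>\<omega>. M x \<omega> $ i) (\<lambda>\<omega>. M x \<omega> $ j))"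

definition k_M ::
  "'w measure \<Rightarrow> ('d \<Rightarrow> 'w \<Rightarrow> real ^ 'p) \<Rightarrow> ('d \<Rightarrow> 'w \<Rightarrow> real) \<Rightarrow> 'd \<Rightarrow> real ^ 'p" where
  "k_M P M Y x = (\<chi> i. cov P (\<lambda>\<omega>. M x \<omega> $ i) (Y x))"

definition M_agg ::
  "'w measure \<Rightarrow> ('d \<Rightarrow> 'w \<Rightarrow> real ^ ('p::finite)) \<Rightarrow> ('d \<Rightarrow> 'w \<Rightarrow> real) \<Rightarrow> 'd \<Rightarrow> 'w \<Rightarrow> real" where
  "M_agg P M Y x \<omega> = k_M P M Y x \<bullet> (matrix_inv (K_M P M x) *v M x \<omega>)"

definition v_agg ::
  "'w measure \<Rightarrow> ('d \<Rightarrow> 'w \<Rightarrow> real ^ ('p::finite)) \<Rightarrow> ('d \<Rightarrow> 'w \<Rightarrow> real) \<Rightarrow> 'd \<Rightarrow> real" where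
  "v_agg P M Y x = (\<integral>\<omega>. (Y x \<omega> - M_agg P M Y x \<omega>)\<^sup>2 \<partial>P)"

text \<open>A process on \<open>D\<close> as a random element of the product space.\<close>

definition process_map :: "'d set \<Rightarrow> ('d \<Rightarrow> 'w \<Rightarrow> 'b) \<Rightarrow> 'w \<Rightarrow> 'd \<Rightarrow> 'b" where
  "process_map D Z \<omega> = (\<lambda>x\<in>D. Z x \<omega>)"

text \<open>\<open>\<epsilon>\<close> is a replicate of $Y - M_{\mathcal A}$: a process on \<open>D\<close> with the same distribution
  (i.e. the same law on the product space, not just the same marginals), independent of the
  whole process $(M_1,\dots,M_p,Y)$. Independence is that of the generated sigma-algebras,
  since \<^const>\<open>prob_space.indep_var\<close> requires both random elements to have the same type.\<close>

definition independent_replicate ::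
  "'w measure \<Rightarrow> 'd set \<Rightarrow> ('d \<Rightarrow> 'w \<Rightarrow> real ^ ('p::finite)) \<Rightarrow> ('d \<Rightarrow> 'w \<Rightarrow> real) \<Rightarrow>
    ('d \<Rightarrow> 'w \<Rightarrow> real) \<Rightarrow> bool" where
  "independent_replicate P D M Y \<epsilon> \<longleftrightarrow>
     (\<forall>x\<in>D. \<epsilon> x \<in> borel_measurable P) \<and>
     distr P (\<Pi>\<^sub>M x\<in>D. borel) (process_map D \<epsilon>) =
       distr P (\<Pi>\<^sub>M x\<in>D. borel) (process_map D (\<lambda>x \<omega>. Y x \<omega> - M_agg P M Y x \<omega>)) \<and>
     prob_space.indep_set P
       (sets (vimage_algebra (space P) (process_map D \<epsilon>) (\<Pi>\<^sub>M x\<in>D. borel)))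
       (sets (vimage_algebra (space P) (process_map D (\<lambda>x \<omega>. (M x \<omega>, Y x \<omega>))) (\<Pi>\<^sub>M x\<in>D. borel)))"

definition k_agg ::
  "'w measure \<Rightarrow> ('d \<Rightarrow> 'w \<Rightarrow> real ^ ('p::finite)) \<Rightarrow> ('d \<Rightarrow> 'w \<Rightarrow> real) \<Rightarrow>
    ('d \<Rightarrow> 'w \<Rightarrow> real) \<Rightarrow> 'd \<Rightarrow> 'd \<Rightarrow> real" where
  "k_agg P M Y \<epsilon> = cov_kernel P (\<lambda>x \<omega>. M_agg P M Y x \<omega> + \<epsilon> x \<omega>)"

text \<open>$\|u\|_K = (u^t K^{-1} u)^{1/2}$. The radicand is nonnegative when \<open>K\<close> is an invertible
  covariance matrix; see \<open>norm_K_squared\<close>.\<close>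

definition norm_K :: "real ^ 'n ^ 'n \<Rightarrow> real ^ ('n::finite) \<Rightarrow> real" where
  "norm_K K u = sqrt (u \<bullet> (matrix_inv K *v u))"

lemma norm_K_squared:
  assumes "invertible K" and psd: "\<And>v. 0 \<le> v \<bullet> (K *v v)"
  shows "(norm_K K u)\<^sup>2 = u \<bullet> (matrix_inv K *v u)"
proof -
  have "K *v (matrix_inv K *v u) = u"
    using assms(1) unfolding invertible_def matrix_inv_def
    by (metis (mono_tags, lifting) matrix_vector_mul_assoc matrix_vector_mul_lid someI_ex)
  with psd[of "matrix_inv K *v u"] have "0 \<le> u \<bullet> (matrix_inv K *v u)"
    by (simp add: inner_commute)
  then show ?thesis by (simp add: norm_K_def)
qed

definition eigenvalues :: "real ^ 'n ^ 'n \<Rightarrow> real set" where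
  "eigenvalues A = {l. \<exists>v. v \<noteq> 0 \<and> A *v v = l *\<^sub>R v}"

text \<open>Used only for symmetric matrices, which have finitely many real eigenvalues and at
  least one.\<close>

definition min_eigenvalue :: "real ^ 'n ^ 'n \<Rightarrow> real" where
  "min_eigenvalue A = Min (eigenvalues A)"

end

theory Submission
  imports Defs
begin

text \<open>By linearity $M_{\mathcal A}(x) = c^t Y(X)$ almost surely for some vector $c$, while
  $M_{full}(x) = b^t Y(X)$ with $K b = k(X,x)$, $K = k(X,X)$. Interpolation gives
  $M_{\mathcal A}(x_i) = Y(x_i)$, so the residual $Y - M_{\mathcal A}$ vanishes at the observation
  points and $k_{\mathcal A}(X,x) = K c$. Since $M_{\mathcal A}(x)$ is the orthogonal projection of
  $Y(x)$ on the span of $M(x)$, one has $c^t K b = c^t K c$. All the claims are then statements about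
  the quadratic form $K$ at $b$, $c$ and $b - c$.\<close>

section \<open>Positive semidefinite matrices\<close>

lemma matrix_inv_cancel:
  fixes A :: "real ^ 'n ^ ('n::finite)"
  assumes "invertible A"
  shows "A *v (matrix_inv A *v u) = u" and "matrix_inv A *v (A *v u) = u"
proof -
  have "A ** matrix_inv A = mat 1 \<and> matrix_inv A ** A = mat 1"
    using assms unfolding invertible_def matrix_inv_def by (metis (mono_tags, lifting) someI_ex)
  then show "A *v (matrix_inv A *v u) = u" "matrix_inv A *v (A *v u) = u"
    by (simp_all add: matrix_vector_mul_assoc)
qed

lemma symmetric_matrix_inner:
  fixes A :: "real ^ 'n ^ ('n::finite)"
  assumes "transpose A = A"
  shows "(A *v u) \<bullet> v = u \<bullet> (A *v v)"
  using dot_lmul_matrix[of u A v] vector_transpose_matrix[of u A] by (simp add: assms)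

lemma matrix_inv_symmetric_inner:
  fixes A :: "real ^ 'n ^ ('n::finite)"
  assumes "invertible A" "transpose A = A"
  shows "u \<bullet> (matrix_inv A *v v) = (matrix_inv A *v u) \<bullet> v"
  using symmetric_matrix_inner[OF assms(2), of "matrix_inv A *v u" "matrix_inv A *v v"]
  by (simp add: matrix_inv_cancel[OF assms(1)])

text \<open>The form evaluated at \<open>s *\<^sub>R u + t *\<^sub>R v\<close> is a nonnegative
  quadratic in \<open>s\<close> and \<open>t\<close>, and suitable values of these give the
  discriminant inequality. Since \<open>A\<close> may be singular, \<open>r = 0\<close> is a case of
  its own.\<close>

lemma psd_Cauchy_Schwarz:
  fixes A :: "real ^ 'n ^ ('n::finite)"
  assumes sym: "transpose A = A" and psd: "\<And>v. 0 \<le> v \<bullet> (A *v v)"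
  shows "(u \<bullet> (A *v v))\<^sup>2 \<le> (u \<bullet> (A *v u)) * (v \<bullet> (A *v v))"
proof -
  define p q r where "p = u \<bullet> (A *v u)" and "q = u \<bullet> (A *v v)" and "r = v \<bullet> (A *v v)"
  have q': "v \<bullet> (A *v u) = q"
    unfolding q_def using symmetric_matrix_inner[OF sym, of v u] by (simp add: inner_commute)
  have quad: "0 \<le> s\<^sup>2 * p + 2 * s * t * q + t\<^sup>2 * r" for s t
  proof -
    have "0 \<le> (s *\<^sub>R u + t *\<^sub>R v) \<bullet> (A *v (s *\<^sub>R u + t *\<^sub>R v))" by (rule psd)
    also have "\<dots> = s\<^sup>2 * p + 2 * s * t * q + t\<^sup>2 * r"
      using q' by (simp add: p_def q_def r_def matrix_vector_right_distrib
          matrix_vector_mult_scaleR inner_simps power2_eq_square algebra_simps)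
    finally show ?thesis .
  qed
  have "q\<^sup>2 \<le> p * r"
  proof (cases "r = 0")
    case True
    show ?thesis
    proof (cases "q = 0")
      case False
      have "0 \<le> p" by (simp add: p_def psd)
      \<comment> \<open>With \<open>r = 0\<close> the quadratic is linear in \<open>t\<close>, so it
        can only stay nonnegative if \<open>q\<close> vanishes: at \<open>s = 2 * q\<close>,
        \<open>t = - (p + 1)\<close> it equals -4 q^2.\<close>
      have "q\<^sup>2 \<le> 0"
        using quad[of "2 * q" "- (2 * p + 1)"] quad[of "2 * q" "- (p + 1)"] True
        by (simp add: power2_eq_square algebra_simps)
      with False show ?thesis by simp
    qed (simp add: True)
  next
    case False
    then have "0 < r" using psd[of v] by (simp add: r_def)
    \<comment> \<open>The choice \<open>s = r\<close>, \<open>t = - q\<close> minimises the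
      quadratic in \<open>t\<close> for this \<open>s\<close>; its value there is the discriminant
      times \<open>r\<close>.\<close>
    have "0 \<le> r * (p * r - q\<^sup>2)"
      using quad[of r "- q"] by (simp add: power2_eq_square algebra_simps)
    with \<open>0 < r\<close> show ?thesis by (simp add: zero_le_mult_iff)
  qed
  then show ?thesis by (simp add: p_def q_def r_def)
qed

text \<open>Cauchy-Schwarz for the pair \<open>A *v v\<close> and \<open>v\<close> bounds the fourth
  power of the norm of \<open>A *v v\<close> by a product with the factor 0.\<close>

lemma psd_kernel:
  fixes A :: "real ^ 'n ^ ('n::finite)"
  assumes "transpose A = A" and "\<And>v. 0 \<le> v \<bullet> (A *v v)" and "v \<bullet> (A *v v) = 0"
  shows "A *v v = 0"
  using psd_Cauchy_Schwarz[OF assms(1,2), of "A *v v" v] assms(3) by simp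

text \<open>Choosing one eigenvector per eigenvalue is injective, and the chosen vectors are nonzero
  and pairwise orthogonal, hence independent, so the dimension bounds their number. Finiteness is
  what gives \<open>Min\<close> its meaning in \<open>min_eigenvalue\<close>.\<close>

lemma finite_eigenvalues_symmetric:
  fixes A :: "real ^ 'n ^ ('n::finite)"
  assumes sym: "transpose A = A"
  shows "finite (eigenvalues A)"
proof -
  define w where "w l = (SOME v. v \<noteq> 0 \<and> A *v v = l *\<^sub>R v)" for l
  have w: "w l \<noteq> 0 \<and> A *v w l = l *\<^sub>R w l" if "l \<in> eigenvalues A" for l
    using that unfolding eigenvalues_def w_def mem_Collect_eq by (rule someI_ex)
  have inj: "inj_on w (eigenvalues A)"
    by (rule inj_onI) (metis scaleR_right_imp_eq w)
  have "orthogonal (w l) (w m)" if "l \<in> eigenvalues A" "m \<in> eigenvalues A" "l \<noteq> m" for l m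
    using symmetric_matrix_inner[OF sym, of "w l" "w m"] that w
    by (auto simp: orthogonal_def)
  then have "pairwise orthogonal (w ` eigenvalues A)"
    by (auto simp: pairwise_def)
  then have "independent (w ` eigenvalues A)"
    by (rule pairwise_orthogonal_independent) (use w in auto)
  then show ?thesis
    using independent_bound finite_imageD[OF _ inj] by blast
qed

text \<open>A minimiser of the Rayleigh quotient is an eigenvector: it lies in the kernel of the
  positive semidefinite matrix \<open>A - l I\<close>.\<close>

lemma symmetric_least_eigenvalue:
  fixes A :: "real ^ 'n ^ ('n::finite)"
  assumes sym: "transpose A = A"
  obtains l where "l \<in> eigenvalues A" and "\<And>v. l * (norm v)\<^sup>2 \<le> v \<bullet> (A *v v)"
proof -
  have "compact (sphere (0 :: real ^ 'n) 1)" "sphere (0 :: real ^ 'n) 1 \<noteq> {}"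
    by auto
  moreover have "continuous_on (sphere 0 1) (\<lambda>v. v \<bullet> (A *v v))"
    by (intro continuous_intros linear_continuous_on linear_linear[THEN iffD2] matrix_vector_mul_linear)
  ultimately obtain v0 where v0: "norm v0 = 1"
    and least: "\<And>v. norm v = 1 \<Longrightarrow> v0 \<bullet> (A *v v0) \<le> v \<bullet> (A *v v)"
    using continuous_attains_inf by (metis dist_0_norm mem_sphere)
  define l where "l = v0 \<bullet> (A *v v0)"
  have Rayleigh: "l * (norm v)\<^sup>2 \<le> v \<bullet> (A *v v)" for v
  proof (cases "v = 0")
    case False
    have "l \<le> (v /\<^sub>R norm v) \<bullet> (A *v (v /\<^sub>R norm v))"
      unfolding l_def by (rule least) (simp add: False)
    then show ?thesis
      using False by (simp add: matrix_vector_mult_scaleR power2_eq_square field_simps)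
  qed simp
  define B where "B = A - mat l"
  have mat_l: "mat l *v v = l *\<^sub>R v" for v :: "real ^ 'n"
    by (simp add: vec_eq_iff matrix_vector_mult_def mat_def if_distrib if_distribR cong: if_cong)
  have B: "B *v v = A *v v - l *\<^sub>R v" for v
    by (simp add: B_def matrix_vector_mult_diff_rdistrib mat_l)
  have "B *v v0 = 0"
  proof (rule psd_kernel)
    show "transpose B = B"
      using sym by (auto simp: B_def transpose_def vec_eq_iff mat_def)
    show "0 \<le> v \<bullet> (B *v v)" for v
      using Rayleigh[of v] by (simp add: B inner_diff_right power2_norm_eq_inner)
    show "v0 \<bullet> (B *v v0) = 0"
      using v0 by (simp add: B inner_diff_right l_def flip: power2_norm_eq_inner)
  qed
  then have "l \<in> eigenvalues A"
    using v0 unfolding eigenvalues_def B by (intro CollectI exI[of _ v0]) auto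
  then show ?thesis using Rayleigh by (rule that)
qed

text \<open>The eigenvalue that bounds the Rayleigh quotient from below is below every other
  eigenvalue, as evaluation at an eigenvector shows. It is therefore the minimum.\<close>

lemma min_eigenvalue_Rayleigh:
  fixes A :: "real ^ 'n ^ ('n::finite)"
  assumes sym: "transpose A = A"
  shows "min_eigenvalue A \<in> eigenvalues A"
    and "min_eigenvalue A * (norm v)\<^sup>2 \<le> v \<bullet> (A *v v)"
proof -
  obtain l where l: "l \<in> eigenvalues A" "\<And>v. l * (norm v)\<^sup>2 \<le> v \<bullet> (A *v v)"
    using symmetric_least_eigenvalue[OF sym] by blast
  have "l \<le> m" if m: "m \<in> eigenvalues A" for m
  proof -
    obtain w where w: "w \<noteq> 0" "A *v w = m *\<^sub>R w"
      using m by (auto simp: eigenvalues_def)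
    then have "l * (norm w)\<^sup>2 \<le> m * (norm w)\<^sup>2"
      using l(2)[of w] by (simp add: power2_norm_eq_inner)
    then show ?thesis using w by simp
  qed
  then have "min_eigenvalue A = l"
    unfolding min_eigenvalue_def
    by (intro Min_eqI finite_eigenvalues_symmetric[OF sym] l)
  with l show "min_eigenvalue A \<in> eigenvalues A" "min_eigenvalue A * (norm v)\<^sup>2 \<le> v \<bullet> (A *v v)"
    by simp_all
qed

text \<open>With \<open>w = matrix_inv K *v u\<close> the squared norm is
  \<open>w \<bullet> u\<close>. The Rayleigh bound and Cauchy-Schwarz enclose it, l |w|^2 \<le> w.u
  \<le> |w| |u|, so |w| \<le> |u| / l, and inserting this on the right gives the claim.\<close>

lemma norm_K_le_norm:
  fixes K :: "real ^ 'n ^ ('n::finite)"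
  assumes inv: "invertible K" and sym: "transpose K = K" and psd: "\<And>v. 0 \<le> v \<bullet> (K *v v)"
    and "min_eigenvalue K \<noteq> 0"
  shows "(norm_K K u)\<^sup>2 \<le> 1 / min_eigenvalue K * (norm u)\<^sup>2"
proof -
  define l where "l = min_eigenvalue K"
  obtain v where v: "v \<noteq> 0" "K *v v = l *\<^sub>R v"
    using min_eigenvalue_Rayleigh(1)[OF sym] by (auto simp: eigenvalues_def l_def)
  \<comment> \<open>Semidefiniteness makes the eigenvalue nonnegative, so the assumption that it is
    nonzero makes it positive and allows division by it.\<close>
  have "0 \<le> l * (norm v)\<^sup>2"
    using psd[of v] v by (simp add: power2_norm_eq_inner)
  then have l: "0 < l"
    using v assms(4) by (auto simp: zero_le_mult_iff l_def)
  define w where "w = matrix_inv K *v u"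
  have u: "u = K *v w"
    by (simp add: w_def matrix_inv_cancel inv)
  have CS: "w \<bullet> u \<le> norm w * norm u" by (rule norm_cauchy_schwarz)
  have "l * (norm w)\<^sup>2 \<le> w \<bullet> u"
    using min_eigenvalue_Rayleigh(2)[OF sym, of w] by (simp add: u l_def)
  with CS have "norm w * (l * norm w) \<le> norm w * norm u"
    by (simp add: power2_eq_square algebra_simps)
  then have "l * norm w \<le> norm u"
    by (cases "w = 0") auto
  then have "norm w * norm u \<le> 1 / l * (norm u)\<^sup>2"
    using l mult_right_mono[of "l * norm w" "norm u" "norm u"]
    by (simp add: field_simps power2_eq_square)
  with CS have "w \<bullet> u \<le> 1 / l * (norm u)\<^sup>2" by simp
  then show ?thesis
    by (simp add: norm_K_squared[OF inv psd] l_def flip: w_def) (simp add: inner_commute)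
qed

text \<open>Both kernel columns, \<open>gcol k X x\<close> and that of the aggregated kernel, turn
  out to be images under \<open>K\<close>; on such vectors the inverse cancels.\<close>

lemma norm_K_squared_mult:
  fixes K :: "real ^ 'n ^ ('n::finite)"
  assumes "invertible K" and "\<And>v. 0 \<le> v \<bullet> (K *v v)"
  shows "(norm_K K (K *v c))\<^sup>2 = c \<bullet> (K *v c)"
  by (simp add: norm_K_squared[OF assms] matrix_inv_cancel[OF assms(1)] inner_commute)

lemma norm_K_nonneg:
  fixes K :: "real ^ 'n ^ ('n::finite)"
  assumes "invertible K" and psd: "\<And>v. 0 \<le> v \<bullet> (K *v v)"
  shows "0 \<le> norm_K K u"
  using psd[of "matrix_inv K *v u"] assms(1)
  by (simp add: norm_K_def matrix_inv_cancel inner_commute)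

text \<open>This is Cauchy-Schwarz for the form \<open>K\<close> at \<open>c\<close> and
  \<open>w = matrix_inv K *v y\<close>, because \<open>c \<bullet> y = c \<bullet> (K *v w)\<close>.
  It yields the pointwise bound on the difference of the predictors.\<close>

lemma abs_inner_le_norm_K:
  fixes K :: "real ^ 'n ^ ('n::finite)"
  assumes inv: "invertible K" and sym: "transpose K = K" and psd: "\<And>v. 0 \<le> v \<bullet> (K *v v)"
  shows "\<bar>c \<bullet> y\<bar> \<le> norm_K K (K *v c) * norm_K K y"
proof (rule power2_le_imp_le)
  define w where "w = matrix_inv K *v y"
  have y: "y = K *v w"
    by (simp add: w_def matrix_inv_cancel inv)
  show "\<bar>c \<bullet> y\<bar>\<^sup>2 \<le> (norm_K K (K *v c) * norm_K K y)\<^sup>2"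
    using psd_Cauchy_Schwarz[OF sym psd, of c w]
    by (simp add: y power_mult_distrib norm_K_squared_mult[OF inv psd])
  show "0 \<le> norm_K K (K *v c) * norm_K K y"
    by (simp add: norm_K_nonneg inv psd)
qed

section \<open>Square-integrable random variables\<close>

text \<open>Measurability of \<open>U\<close> is a separate conjunct because it does not follow from
  that of the square.\<close>

definition square_integrable :: "'w measure \<Rightarrow> ('w \<Rightarrow> real) \<Rightarrow> bool" where
  "square_integrable P U \<longleftrightarrow> U \<in> borel_measurable P \<and> integrable P (\<lambda>\<omega>. (U \<omega>)\<^sup>2)"

lemma square_integrable_mult:
  assumes "square_integrable P U" "square_integrable P V"
  shows "integrable P (\<lambda>\<omega>. U \<omega> * V \<omega>)"
proof (rule Bochner_Integration.integrable_bound)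
  show "integrable P (\<lambda>\<omega>. (U \<omega>)\<^sup>2 + (V \<omega>)\<^sup>2)"
    using assms by (simp add: square_integrable_def)
  show "(\<lambda>\<omega>. U \<omega> * V \<omega>) \<in> borel_measurable P"
    using assms by (auto simp: square_integrable_def)
  show "AE \<omega> in P. norm (U \<omega> * V \<omega>) \<le> norm ((U \<omega>)\<^sup>2 + (V \<omega>)\<^sup>2)"
  proof (rule AE_I2)
    fix \<omega>
    \<comment> \<open>The right side is twice the difference between U^2 + V^2 and |U V|.\<close>
    have "0 \<le> (\<bar>U \<omega>\<bar> - \<bar>V \<omega>\<bar>)\<^sup>2 + (U \<omega>)\<^sup>2 + (V \<omega>)\<^sup>2" by simp
    then show "norm (U \<omega> * V \<omega>) \<le> norm ((U \<omega>)\<^sup>2 + (V \<omega>)\<^sup>2)"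
      by (simp add: power2_diff abs_mult)
  qed
qed

lemma square_integrable_add:
  assumes "square_integrable P U" "square_integrable P V"
  shows "square_integrable P (\<lambda>\<omega>. U \<omega> + V \<omega>)"
  using assms square_integrable_mult[OF assms]
  by (auto simp: square_integrable_def power2_sum mult.assoc)

lemma square_integrable_cmult:
  assumes "square_integrable P U"
  shows "square_integrable P (\<lambda>\<omega>. r * U \<omega>)"
  using assms by (auto simp: square_integrable_def power_mult_distrib)

lemma square_integrable_diff:
  assumes "square_integrable P U" "square_integrable P V"
  shows "square_integrable P (\<lambda>\<omega>. U \<omega> - V \<omega>)"
  using square_integrable_add[OF assms(1) square_integrable_cmult[OF assms(2), of "-1"]] by simp

lemma square_integrable_sum:
  assumes "finite I" "\<And>i. i \<in> I \<Longrightarrow> square_integrable P (U i)"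
  shows "square_integrable P (\<lambda>\<omega>. \<Sum>i\<in>I. U i \<omega>)"
  using assms
  by (induction I rule: finite_induct) (auto intro: square_integrable_add simp: square_integrable_def[of _ "\<lambda>_. 0"])

lemma square_integrable_inner:
  fixes Z :: "'w \<Rightarrow> real ^ ('n::finite)"
  assumes "\<And>i. square_integrable P (\<lambda>\<omega>. Z \<omega> $ i)"
  shows "square_integrable P (\<lambda>\<omega>. a \<bullet> Z \<omega>)"
proof -
  have "square_integrable P (\<lambda>\<omega>. \<Sum>i\<in>UNIV. a $ i * Z \<omega> $ i)"
    by (rule square_integrable_sum) (simp_all add: square_integrable_cmult assms)
  then show ?thesis by (simp add: inner_vec_def)
qed

section \<open>Second moments of random vectors; laws and independence of processes\<close>

context prob_space
begin

lemma square_integrable_integrable: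
  "square_integrable M U \<Longrightarrow> integrable M U"
  by (auto simp: square_integrable_def intro: square_integrable_imp_integrable)

text \<open>The moments are uncentered, which makes the algebra bilinear from the start; for
  centered vectors \<open>Gram\<close> and \<open>cross\<close> are the covariance matrix and the
  cross-covariance vector.\<close>

definition Gram :: "('a \<Rightarrow> real ^ 'n) \<Rightarrow> real ^ 'n ^ ('n::finite)" where
  "Gram Z = (\<chi> i j. expectation (\<lambda>\<omega>. Z \<omega> $ i * Z \<omega> $ j))"

definition cross :: "('a \<Rightarrow> real ^ 'n) \<Rightarrow> ('a \<Rightarrow> real) \<Rightarrow> real ^ ('n::finite)" where
  "cross Z U = (\<chi> i. expectation (\<lambda>\<omega>. Z \<omega> $ i * U \<omega>))"

lemma transpose_Gram: "transpose (Gram Z) = Gram Z"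
  by (simp add: Gram_def transpose_def mult.commute)

lemma expectation_inner_mult:
  assumes Z: "\<And>i. square_integrable M (\<lambda>\<omega>. Z \<omega> $ i)" and U: "square_integrable M U"
  shows "expectation (\<lambda>\<omega>. (a \<bullet> Z \<omega>) * U \<omega>) = a \<bullet> cross Z U"
proof -
  have "expectation (\<lambda>\<omega>. (a \<bullet> Z \<omega>) * U \<omega>) = expectation (\<lambda>\<omega>. \<Sum>i\<in>UNIV. a $ i * (Z \<omega> $ i * U \<omega>))"
    by (simp add: inner_vec_def sum_distrib_right mult.assoc)
  also have "\<dots> = (\<Sum>i\<in>UNIV. a $ i * expectation (\<lambda>\<omega>. Z \<omega> $ i * U \<omega>))"
    using square_integrable_mult[OF Z U] by (subst Bochner_Integration.integral_sum) auto
  finally show ?thesis by (simp add: inner_vec_def cross_def)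
qed

lemma cross_inner:
  assumes Z: "\<And>i. square_integrable M (\<lambda>\<omega>. Z \<omega> $ i)"
  shows "cross Z (\<lambda>\<omega>. a \<bullet> Z \<omega>) = Gram Z *v a"
proof -
  have "expectation (\<lambda>\<omega>. Z \<omega> $ i * (a \<bullet> Z \<omega>)) = (Gram Z *v a) $ i" for i
    using expectation_inner_mult[OF Z Z, of a i]
    by (simp add: mult.commute inner_vec_def cross_def Gram_def matrix_vector_mult_def)
  then show ?thesis by (simp add: cross_def vec_eq_iff)
qed

lemma expectation_inner_inner:
  assumes Z: "\<And>i. square_integrable M (\<lambda>\<omega>. Z \<omega> $ i)"
  shows "expectation (\<lambda>\<omega>. (a \<bullet> Z \<omega>) * (b \<bullet> Z \<omega>)) = a \<bullet> (Gram Z *v b)"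
  using expectation_inner_mult[OF Z square_integrable_inner[OF Z]] cross_inner[OF Z] by simp

lemma Gram_psd:
  assumes "\<And>i. square_integrable M (\<lambda>\<omega>. Z \<omega> $ i)"
  shows "0 \<le> v \<bullet> (Gram Z *v v)"
  unfolding expectation_inner_inner[OF assms, symmetric] by simp

text \<open>Here \<open>a\<close> solves the normal equations, and completing the square around it
  isolates the excess error of any other \<open>b\<close>. Taking \<open>b\<close> to be
  \<open>a\<close> gives the error of the aggregated predictor, and a unit vector gives that of a
  single submodel.\<close>

lemma mean_square_error_linear:
  assumes Z: "\<And>i. square_integrable M (\<lambda>\<omega>. Z \<omega> $ i)" and U: "square_integrable M U"
    and a: "Gram Z *v a = cross Z U"
  shows "expectation (\<lambda>\<omega>. (U \<omega> - b \<bullet> Z \<omega>)\<^sup>2) =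
    expectation (\<lambda>\<omega>. (U \<omega>)\<^sup>2) - a \<bullet> (Gram Z *v a) + (b - a) \<bullet> (Gram Z *v (b - a))"
proof -
  note bZ = square_integrable_inner[OF Z, of b]
  have "expectation (\<lambda>\<omega>. (U \<omega> - b \<bullet> Z \<omega>)\<^sup>2) =
      expectation (\<lambda>\<omega>. (U \<omega>)\<^sup>2 + (b \<bullet> Z \<omega>) * (b \<bullet> Z \<omega>) - 2 * ((b \<bullet> Z \<omega>) * U \<omega>))"
    by (simp add: power2_eq_square algebra_simps)
  also have "\<dots> = expectation (\<lambda>\<omega>. (U \<omega>)\<^sup>2) + expectation (\<lambda>\<omega>. (b \<bullet> Z \<omega>) * (b \<bullet> Z \<omega>))
      - 2 * expectation (\<lambda>\<omega>. (b \<bullet> Z \<omega>) * U \<omega>)"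
    using U square_integrable_mult[OF bZ bZ] square_integrable_mult[OF bZ U]
    by (simp add: square_integrable_def)
  also have "\<dots> = expectation (\<lambda>\<omega>. (U \<omega>)\<^sup>2) + b \<bullet> (Gram Z *v b) - 2 * (b \<bullet> (Gram Z *v a))"
    by (simp add: expectation_inner_inner[OF Z] expectation_inner_mult[OF Z U] a)
  finally show ?thesis
    using symmetric_matrix_inner[OF transpose_Gram, of Z a b]
    by (simp add: matrix_vector_mult_diff_distrib inner_diff_left inner_diff_right inner_commute)
qed

lemma cov_centered:
  assumes "expectation U = 0" "expectation V = 0"
  shows "cov M U V = expectation (\<lambda>\<omega>. U \<omega> * V \<omega>)"
  using assms by (simp add: cov_def)

text \<open>The sigma-algebras generated by \<open>U\<close> and \<open>V\<close> lie inside
  \<open>F\<close> and \<open>G\<close>, and independence passes to sub-sigma-algebras. This turns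
  the condition in \<open>independent_replicate\<close> into a statement about individual
  variables.\<close>

lemma indep_var_of_indep_set:
  assumes indep: "indep_set (sets F) (sets G)"
    and sp: "space F = space M" "space G = space M"
    and U: "U \<in> measurable F S" and V: "V \<in> measurable G T"
  shows "indep_var S U T V"
proof -
  have sub: "sets F \<subseteq> events" "sets G \<subseteq> events"
    and pr: "\<And>A B. A \<in> sets F \<Longrightarrow> B \<in> sets G \<Longrightarrow> prob (A \<inter> B) = prob A * prob B"
    using indep by (auto simp: indep_sets2_eq)
  have UA: "U -` A \<inter> space M \<in> sets F" if "A \<in> sets S" for A
    using measurable_sets[OF U that] sp by simp
  have VA: "V -` A \<inter> space M \<in> sets G" if "A \<in> sets T" for A
    using measurable_sets[OF V that] sp by simp
  have "random_variable S U" "random_variable T V"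
    using UA VA sub measurable_space[OF U] measurable_space[OF V] sp
    by (auto intro!: measurableI)
  moreover have "sigma_sets (space M) {U -` A \<inter> space M | A. A \<in> sets S} \<subseteq> sets F"
    using UA sets.sigma_sets_subset[of "{U -` A \<inter> space M | A. A \<in> sets S}" F]
    unfolding sp by blast
  moreover have "sigma_sets (space M) {V -` A \<inter> space M | A. A \<in> sets T} \<subseteq> sets G"
    using VA sets.sigma_sets_subset[of "{V -` A \<inter> space M | A. A \<in> sets T}" G]
    unfolding sp by blast
  ultimately show ?thesis
    unfolding indep_var_eq indep_sets2_eq using sub pr by blast
qed

lemma measurable_process_component:
  assumes "x \<in> D"
  shows "Z x \<in> borel_measurable (vimage_algebra (space M) (process_map D Z) (\<Pi>\<^sub>M x\<in>D. borel))"
proof -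
  have "process_map D Z \<in> measurable (vimage_algebra (space M) (process_map D Z) (\<Pi>\<^sub>M x\<in>D. borel))
      (\<Pi>\<^sub>M x\<in>D. borel)"
    by (rule measurable_vimage_algebra1) (auto simp: process_map_def space_PiM)
  from measurable_component_singleton[OF assms, THEN measurable_compose[OF this]]
  show ?thesis using assms by (simp add: process_map_def)
qed

lemma measurable_process_map:
  assumes "\<forall>x\<in>D. Z x \<in> borel_measurable M"
  shows "process_map D Z \<in> measurable M (\<Pi>\<^sub>M x\<in>D. borel)"
  unfolding process_map_def using assms by (intro measurable_restrict) auto

text \<open>Both sides are integrals against the same image measure on the product space. As
  \<open>f\<close> may read several coordinates, covariances between two points are covered as
  well.\<close>

lemma expectation_same_law:
  fixes f :: "_ \<Rightarrow> real"
  assumes "\<forall>x\<in>D. Z x \<in> borel_measurable M" "\<forall>x\<in>D. W x \<in> borel_measurable M"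
    and "distr M (\<Pi>\<^sub>M x\<in>D. borel) (process_map D Z) = distr M (\<Pi>\<^sub>M x\<in>D. borel) (process_map D W)"
    and "f \<in> borel_measurable (\<Pi>\<^sub>M x\<in>D. borel)"
  shows "expectation (\<lambda>\<omega>. f (process_map D Z \<omega>)) = expectation (\<lambda>\<omega>. f (process_map D W \<omega>))"
    and "integrable M (\<lambda>\<omega>. f (process_map D Z \<omega>)) \<longleftrightarrow> integrable M (\<lambda>\<omega>. f (process_map D W \<omega>))"
proof -
  note Z = measurable_process_map[OF assms(1)] and W = measurable_process_map[OF assms(2)]
  show "expectation (\<lambda>\<omega>. f (process_map D Z \<omega>)) = expectation (\<lambda>\<omega>. f (process_map D W \<omega>))"
    unfolding integral_distr[OF Z assms(4), symmetric] integral_distr[OF W assms(4), symmetric]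
    by (simp only: assms(3))
  show "integrable M (\<lambda>\<omega>. f (process_map D Z \<omega>)) \<longleftrightarrow> integrable M (\<lambda>\<omega>. f (process_map D W \<omega>))"
    unfolding integrable_distr_eq[OF Z assms(4), symmetric] integrable_distr_eq[OF W assms(4), symmetric]
    by (simp only: assms(3))
qed

end

section \<open>The aggregated predictor\<close>

locale nested_kriging = prob_space P for P :: "'w measure" +
  fixes D :: "(real ^ 'd) set"
    and M :: "real ^ 'd \<Rightarrow> 'w \<Rightarrow> real ^ 'p"
    and Y :: "real ^ 'd \<Rightarrow> 'w \<Rightarrow> real"
    and X :: "real ^ 'd ^ 'n"
    and \<epsilon> :: "real ^ 'd \<Rightarrow> 'w \<Rightarrow> real"
  assumes Y_sq: "\<And>x. x \<in> D \<Longrightarrow> square_integrable P (Y x)"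
    and Y_centered: "\<And>x. x \<in> D \<Longrightarrow> expectation (Y x) = 0"
    and M_sq: "\<And>x i. x \<in> D \<Longrightarrow> square_integrable P (\<lambda>\<omega>. M x \<omega> $ i)"
    and M_centered: "\<And>x i. x \<in> D \<Longrightarrow> expectation (\<lambda>\<omega>. M x \<omega> $ i) = 0"
    and K_M_inv: "\<And>x. x \<in> D \<Longrightarrow> invertible (K_M P M x)"
    and X_in_D: "\<And>i. X $ i \<in> D"
    and K_inv: "invertible (gmat (cov_kernel P Y) X)"
    and repl: "independent_replicate P D M Y \<epsilon>"
    and linearity: "\<And>x. x \<in> D \<Longrightarrow> \<exists>\<Lambda> :: real ^ 'n ^ 'p. AE \<omega> in P. M x \<omega> = \<Lambda> *v obs Y X \<omega>"
    and interpolation: "\<And>i. \<exists>j. AE \<omega> in P. M (X $ i) \<omega> $ j = Y (X $ i) \<omega>"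
begin

abbreviation "k \<equiv> cov_kernel P Y"
abbreviation "K \<equiv> gmat k X"
abbreviation "MA \<equiv> M_agg P M Y"

text \<open>\<open>M_agg\<close> applies the inverse to the random vector; by symmetry of
  \<open>K_M\<close> it can be moved onto \<open>k_M\<close>, which leaves deterministic weights for
  \<open>M x\<close>.\<close>

definition coef_agg :: "real ^ 'd \<Rightarrow> real ^ 'p" where
  "coef_agg x = matrix_inv (K_M P M x) *v k_M P M Y x"

definition coef_full :: "real ^ 'd \<Rightarrow> real ^ 'n" where
  "coef_full x = matrix_inv K *v gcol k X x"

section \<open>Kernels and predictors in terms of second moments\<close>

lemma obs_sq: "square_integrable P (\<lambda>\<omega>. obs Y X \<omega> $ i)"
  by (simp add: obs_def Y_sq X_in_D)

lemma k_eq: "x \<in> D \<Longrightarrow> x' \<in> D \<Longrightarrow> k x x' = expectation (\<lambda>\<omega>. Y x \<omega> * Y x' \<omega>)"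
  by (simp add: cov_kernel_def cov_centered Y_centered)

lemma K_eq_Gram: "K = Gram (obs Y X)"
  by (simp add: gmat_def Gram_def vec_eq_iff obs_def k_eq X_in_D)

lemma gcol_k: "x \<in> D \<Longrightarrow> gcol k X x = cross (obs Y X) (Y x)"
  by (simp add: gcol_def cross_def vec_eq_iff obs_def k_eq X_in_D)

lemma grow_k: "x \<in> D \<Longrightarrow> grow k x X = gcol k X x"
  by (simp add: gcol_def grow_def vec_eq_iff k_eq X_in_D mult.commute)

lemma K_M_eq_Gram: "x \<in> D \<Longrightarrow> K_M P M x = Gram (M x)"
  by (simp add: K_M_def Gram_def vec_eq_iff cov_centered M_centered)

lemma k_M_eq_cross: "x \<in> D \<Longrightarrow> k_M P M Y x = cross (M x) (Y x)"
  by (simp add: k_M_def cross_def vec_eq_iff cov_centered M_centered Y_centered)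

lemma K_sym: "transpose K = K" and K_psd: "0 \<le> v \<bullet> (K *v v)"
  by (simp_all add: K_eq_Gram transpose_Gram Gram_psd obs_sq)

lemma K_coef_full: "K *v coef_full x = gcol k X x"
  by (simp add: coef_full_def matrix_inv_cancel K_inv)

text \<open>These are the normal equations for predicting \<open>Y x\<close> from
  \<open>M x\<close>: they say that the error \<open>Y x - MA x\<close> is orthogonal to every
  submodel.\<close>

lemma Gram_coef_agg: "x \<in> D \<Longrightarrow> Gram (M x) *v coef_agg x = cross (M x) (Y x)"
  using K_M_inv[of x] by (simp add: coef_agg_def matrix_inv_cancel K_M_eq_Gram k_M_eq_cross)

lemma M_agg_eq: "x \<in> D \<Longrightarrow> MA x = (\<lambda>\<omega>. coef_agg x \<bullet> M x \<omega>)"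
  using K_M_inv[of x]
  by (simp add: fun_eq_iff M_agg_def coef_agg_def matrix_inv_symmetric_inner K_M_eq_Gram transpose_Gram)

lemma M_full_eq: "x \<in> D \<Longrightarrow> M_full P Y X x \<omega> = coef_full x \<bullet> obs Y X \<omega>"
  by (simp add: M_full_def coef_full_def grow_k matrix_inv_symmetric_inner K_inv K_sym)

lemma M_agg_sq: "x \<in> D \<Longrightarrow> square_integrable P (MA x)"
  using square_integrable_inner[OF M_sq, of x "coef_agg x"] by (simp add: M_agg_eq)

lemma M_agg_centered: "x \<in> D \<Longrightarrow> expectation (MA x) = 0"
proof -
  assume x: "x \<in> D"
  \<comment> \<open>The mean of the linear combination is read off as its cross moment with the
    constant 1.\<close>
  have "square_integrable P (\<lambda>_. 1)" by (simp add: square_integrable_def)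
  from expectation_inner_mult[OF M_sq[OF x] this, of "coef_agg x"]
  show ?thesis by (simp add: M_agg_eq[OF x] cross_def M_centered[OF x] inner_vec_def)
qed

text \<open>If submodel \<open>j\<close> equals \<open>Y\<close> at the point, then
  \<open>k_M\<close> is column \<open>j\<close> of \<open>K_M\<close> there. Invertibility forces
  the weights to be the unit vector \<open>axis j 1\<close>, so the aggregate is submodel
  \<open>j\<close>.\<close>

lemma M_agg_interpolates: "AE \<omega> in P. MA (X $ i) \<omega> = Y (X $ i) \<omega>"
proof -
  let ?x = "X $ i"
  obtain j where j: "AE \<omega> in P. M ?x \<omega> $ j = Y ?x \<omega>"
    using interpolation by blast
  have [measurable]: "(\<lambda>\<omega>. M ?x \<omega> $ l) \<in> borel_measurable P" "Y ?x \<in> borel_measurable P" for l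
    using M_sq[OF X_in_D] Y_sq[OF X_in_D] by (auto simp: square_integrable_def)
  have cross_at: "cross (M ?x) (Y ?x) $ l = (Gram (M ?x) *v axis j 1) $ l" for l
  proof -
    have "expectation (\<lambda>\<omega>. M ?x \<omega> $ l * Y ?x \<omega>) = expectation (\<lambda>\<omega>. M ?x \<omega> $ l * M ?x \<omega> $ j)"
      using j by (intro integral_cong_AE) (measurable, auto)
    then show ?thesis
      by (simp add: cross_def Gram_def matrix_vector_mul_component inner_axis)
  qed
  have "cross (M ?x) (Y ?x) = Gram (M ?x) *v axis j 1"
    unfolding vec_eq_iff using cross_at by blast
  then have "coef_agg ?x = axis j 1"
    using K_M_inv[OF X_in_D, of i]
    by (simp add: coef_agg_def k_M_eq_cross X_in_D K_M_eq_Gram matrix_inv_cancel)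
  with j show ?thesis
    by (simp add: M_agg_eq X_in_D inner_axis')
qed

section \<open>Moments of the replicate and the aggregated covariance\<close>

definition residual :: "real ^ 'd \<Rightarrow> 'w \<Rightarrow> real" where
  "residual x \<omega> = Y x \<omega> - MA x \<omega>"

lemma residual_sq: "x \<in> D \<Longrightarrow> square_integrable P (residual x)"
  using square_integrable_diff[OF Y_sq M_agg_sq, of x x] by (simp add: residual_def[abs_def])

text \<open>The replicate is only assumed measurable and equal in law to the residual; its
  integrability and its first and second moments are all transported from there.\<close>

lemma eps_moments:
  assumes x: "x \<in> D"
  shows "square_integrable P (\<epsilon> x)" and "expectation (\<epsilon> x) = 0"
    and "x' \<in> D \<Longrightarrow> expectation (\<lambda>\<omega>. \<epsilon> x \<omega> * \<epsilon> x' \<omega>) = expectation (\<lambda>\<omega>. residual x \<omega> * residual x' \<omega>)"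
proof -
  have eps: "\<forall>x\<in>D. \<epsilon> x \<in> borel_measurable P"
    and law: "distr P (\<Pi>\<^sub>M x\<in>D. borel) (process_map D \<epsilon>) = distr P (\<Pi>\<^sub>M x\<in>D. borel) (process_map D residual)"
    using repl by (simp_all add: independent_replicate_def residual_def[abs_def])
  have R: "\<forall>x\<in>D. residual x \<in> borel_measurable P"
    using residual_sq by (auto simp: square_integrable_def)
  note E = expectation_same_law[OF eps R law]
  have comp[measurable]: "(\<lambda>f. f x) \<in> borel_measurable (\<Pi>\<^sub>M x\<in>D. (borel :: real measure))" if "x \<in> D" for x
    using measurable_component_singleton[OF that] .
  have "integrable P (\<lambda>\<omega>. (\<epsilon> x \<omega>)\<^sup>2)"
    using E(2)[of "\<lambda>f. (f x)\<^sup>2"] residual_sq[OF x] x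
    by (simp add: process_map_def square_integrable_def)
  then show "square_integrable P (\<epsilon> x)"
    using eps x by (simp add: square_integrable_def)
  have "expectation (\<epsilon> x) = expectation (residual x)"
    using E(1)[of "\<lambda>f. f x"] x by (simp add: process_map_def)
  also have "\<dots> = 0"
    unfolding residual_def using x
    by (simp add: square_integrable_integrable Y_sq M_agg_sq Y_centered M_agg_centered)
  finally show "expectation (\<epsilon> x) = 0" .
  show "expectation (\<lambda>\<omega>. \<epsilon> x \<omega> * \<epsilon> x' \<omega>) = expectation (\<lambda>\<omega>. residual x \<omega> * residual x' \<omega>)" if "x' \<in> D"
    using E(1)[of "\<lambda>f. f x * f x'"] x that by (simp add: process_map_def)
qed

text \<open>\<open>MA x'\<close> is a function of \<open>M x'\<close> and so measurable for the
  sigma-algebra of the process (M, Y), from which \<epsilon> is independent. The expectation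
  factors, and \<epsilon> is centered.\<close>

lemma M_agg_eps_uncorrelated:
  assumes x: "x \<in> D" and x': "x' \<in> D"
  shows "expectation (\<lambda>\<omega>. \<epsilon> x \<omega> * MA x' \<omega>) = 0"
proof -
  let ?F = "vimage_algebra (space P) (process_map D \<epsilon>) (\<Pi>\<^sub>M x\<in>D. borel)"
  let ?G = "vimage_algebra (space P) (process_map D (\<lambda>x \<omega>. (M x \<omega>, Y x \<omega>))) (\<Pi>\<^sub>M x\<in>D. borel)"
  have "(\<lambda>\<omega>. (M x' \<omega>, Y x' \<omega>)) \<in> borel_measurable ?G"
    by (rule measurable_process_component[OF x', of "\<lambda>x \<omega>. (M x \<omega>, Y x \<omega>)"])
  \<comment> \<open>Independence is stated for the process of pairs, so \<open>MA x'\<close> is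
    written as a continuous function of the pair.\<close>
  then have "(\<lambda>\<omega>. coef_agg x' \<bullet> fst (M x' \<omega>, Y x' \<omega>)) \<in> borel_measurable ?G"
    by (rule measurable_compose)
      (intro borel_measurable_continuous_onI continuous_intros)
  then have "MA x' \<in> borel_measurable ?G"
    using M_agg_eq[OF x'] by simp
  moreover have "\<epsilon> x \<in> borel_measurable ?F"
    by (rule measurable_process_component[OF x])
  moreover have "indep_set (sets ?F) (sets ?G)"
    using repl by (simp add: independent_replicate_def)
  ultimately have "indep_var borel (\<epsilon> x) borel (MA x')"
    by (intro indep_var_of_indep_set[of ?F ?G]) (simp_all only: space_vimage_algebra)
  then have "expectation (\<lambda>\<omega>. \<epsilon> x \<omega> * MA x' \<omega>) = expectation (\<epsilon> x) * expectation (MA x')"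
    by (rule indep_var_lebesgue_integral)
      (intro square_integrable_integrable eps_moments(1)[OF x] M_agg_sq[OF x'])+
  then show ?thesis by (simp add: eps_moments(2)[OF x])
qed

text \<open>The mixed terms vanish because the replicate is uncorrelated with \<open>MA\<close>, and
  the covariance of the replicate is that of the residual.\<close>

lemma k_agg_eq:
  assumes x: "x \<in> D" and x': "x' \<in> D"
  shows "k_agg P M Y \<epsilon> x x' =
    expectation (\<lambda>\<omega>. MA x \<omega> * MA x' \<omega>) + expectation (\<lambda>\<omega>. residual x \<omega> * residual x' \<omega>)"
proof -
  have zero: "expectation (\<lambda>\<omega>. MA z \<omega> + \<epsilon> z \<omega>) = 0" if "z \<in> D" for z
    using that
    by (simp add: square_integrable_integrable M_agg_sq eps_moments M_agg_centered)
  have "k_agg P M Y \<epsilon> x x' = expectation (\<lambda>\<omega>. (MA x \<omega> + \<epsilon> x \<omega>) * (MA x' \<omega> + \<epsilon> x' \<omega>))"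
    by (simp add: k_agg_def cov_kernel_def cov_centered zero x x')
  also have "\<dots> = expectation (\<lambda>\<omega>. MA x \<omega> * MA x' \<omega> + \<epsilon> x' \<omega> * MA x \<omega> + \<epsilon> x \<omega> * MA x' \<omega>
      + \<epsilon> x \<omega> * \<epsilon> x' \<omega>)"
    by (simp add: algebra_simps)
  also have "\<dots> = expectation (\<lambda>\<omega>. MA x \<omega> * MA x' \<omega>) + expectation (\<lambda>\<omega>. \<epsilon> x' \<omega> * MA x \<omega>)
      + expectation (\<lambda>\<omega>. \<epsilon> x \<omega> * MA x' \<omega>) + expectation (\<lambda>\<omega>. \<epsilon> x \<omega> * \<epsilon> x' \<omega>)"
    using x x' by (simp add: square_integrable_mult M_agg_sq eps_moments)
  finally show ?thesis
    using x x' by (simp add: M_agg_eps_uncorrelated eps_moments)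
qed

text \<open>By interpolation the residual at an observation point is almost surely zero, which
  removes the second term of \<open>k_agg_eq\<close> and replaces \<open>MA\<close> by
  \<open>Y\<close> in the first.\<close>

lemma k_agg_at_observation:
  assumes x: "x \<in> D"
  shows "k_agg P M Y \<epsilon> (X $ i) x = expectation (\<lambda>\<omega>. Y (X $ i) \<omega> * MA x \<omega>)"
proof -
  have [measurable]: "MA z \<in> borel_measurable P" "Y z \<in> borel_measurable P"
      "residual z \<in> borel_measurable P" if "z \<in> D" for z
    using M_agg_sq[OF that] Y_sq[OF that] residual_sq[OF that] by (auto simp: square_integrable_def)
  have "expectation (\<lambda>\<omega>. MA (X $ i) \<omega> * MA x \<omega>) = expectation (\<lambda>\<omega>. Y (X $ i) \<omega> * MA x \<omega>)"
    using M_agg_interpolates[of i] x X_in_D by (intro integral_cong_AE) auto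
  moreover have "expectation (\<lambda>\<omega>. residual (X $ i) \<omega> * residual x \<omega>) = expectation (\<lambda>_. 0)"
    using M_agg_interpolates[of i] x X_in_D by (intro integral_cong_AE) (auto simp: residual_def)
  ultimately show ?thesis
    by (simp add: k_agg_eq x X_in_D)
qed

text \<open>The vector \<open>c\<close> re-expresses the aggregate through the observations. The
  last two facts express its second moment in both coordinate systems and the orthogonality of the
  error \<open>Y x - MA x\<close> to \<open>MA x\<close>.\<close>

lemma M_agg_linear:
  assumes x: "x \<in> D"
  obtains c where "AE \<omega> in P. MA x \<omega> = c \<bullet> obs Y X \<omega>"
    and "gcol (k_agg P M Y \<epsilon>) X x = K *v c"
    and "c \<bullet> (K *v c) = coef_agg x \<bullet> (Gram (M x) *v coef_agg x)"
    and "c \<bullet> (K *v coef_full x) = c \<bullet> (K *v c)"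
proof -
  obtain \<Lambda> :: "real ^ 'n ^ 'p" where \<Lambda>: "AE \<omega> in P. M x \<omega> = \<Lambda> *v obs Y X \<omega>"
    using linearity[OF x] by blast
  define c where "c = transpose \<Lambda> *v coef_agg x"
  have c: "AE \<omega> in P. MA x \<omega> = c \<bullet> obs Y X \<omega>"
    using \<Lambda> by eventually_elim
      (simp add: M_agg_eq[OF x] c_def dot_lmul_matrix flip: vector_transpose_matrix)
  have swap: "expectation (\<lambda>\<omega>. MA x \<omega> * U \<omega>) = expectation (\<lambda>\<omega>. (c \<bullet> obs Y X \<omega>) * U \<omega>)"
    if "square_integrable P U" for U
  proof (rule integral_cong_AE)
    show "AE \<omega> in P. MA x \<omega> * U \<omega> = (c \<bullet> obs Y X \<omega>) * U \<omega>"
      using c by eventually_elim simp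
    show "(\<lambda>\<omega>. MA x \<omega> * U \<omega>) \<in> borel_measurable P"
      using that M_agg_sq[OF x] by (auto simp: square_integrable_def)
    show "(\<lambda>\<omega>. (c \<bullet> obs Y X \<omega>) * U \<omega>) \<in> borel_measurable P"
      using that square_integrable_inner[OF obs_sq, of c] by (auto simp: square_integrable_def)
  qed
  note cO = square_integrable_inner[OF obs_sq, of c]
  have "gcol (k_agg P M Y \<epsilon>) X x = cross (obs Y X) (\<lambda>\<omega>. c \<bullet> obs Y X \<omega>)"
    using swap[OF obs_sq]
    by (simp add: gcol_def cross_def vec_eq_iff k_agg_at_observation[OF x] obs_def mult.commute)
  then have kA: "gcol (k_agg P M Y \<epsilon>) X x = K *v c"
    by (simp add: cross_inner[OF obs_sq] K_eq_Gram)
  \<comment> \<open>The almost sure representation is substituted in one factor at a time: first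
    with \<open>U\<close> equal to \<open>MA x\<close>, then with \<open>U\<close> equal to the
    linear form in the observations.\<close>
  have "expectation (\<lambda>\<omega>. MA x \<omega> * MA x \<omega>) = expectation (\<lambda>\<omega>. MA x \<omega> * (c \<bullet> obs Y X \<omega>))"
    using swap[OF M_agg_sq[OF x]] by (simp add: mult.commute)
  also have "\<dots> = c \<bullet> (K *v c)"
    by (simp add: swap[OF cO] expectation_inner_inner[OF obs_sq] K_eq_Gram)
  finally have cc: "c \<bullet> (K *v c) = coef_agg x \<bullet> (Gram (M x) *v coef_agg x)"
    by (simp add: M_agg_eq[OF x] expectation_inner_inner[OF M_sq[OF x]])
  have "c \<bullet> (K *v coef_full x) = expectation (\<lambda>\<omega>. MA x \<omega> * Y x \<omega>)"
    by (simp add: swap[OF Y_sq[OF x]] expectation_inner_mult[OF obs_sq Y_sq[OF x]]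
        K_coef_full gcol_k[OF x])
  \<comment> \<open>The normal equations enter here: the cross moment of \<open>MA x\<close> with
    \<open>Y x\<close> is the second moment of \<open>MA x\<close>.\<close>
  also have "\<dots> = coef_agg x \<bullet> (Gram (M x) *v coef_agg x)"
    by (simp add: M_agg_eq[OF x] expectation_inner_mult[OF M_sq Y_sq] x Gram_coef_agg)
  finally show ?thesis
    using that[OF c kA cc] cc by simp
qed

text \<open>Both predictors are linear in the observations, with coefficients \<open>b\<close> and
  \<open>c\<close>, which reduces the comparison to the form \<open>K\<close>. The last clause
  compares with one submodel \<open>j\<close> at a time; the minimum is taken in the
  theorem.\<close>

lemma aggregation_error:
  assumes x: "x \<in> D"
  shows "expectation (\<lambda>\<omega>. (MA x \<omega> - M_full P Y X x \<omega>)\<^sup>2)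
      = (norm_K K (gcol k X x - gcol (k_agg P M Y \<epsilon>) X x))\<^sup>2" (is ?mse)
    and "v_agg P M Y x - v_full P Y X x
      = (norm_K K (gcol k X x))\<^sup>2 - (norm_K K (gcol (k_agg P M Y \<epsilon>) X x))\<^sup>2" (is ?var)
    and "AE \<omega> in P. \<bar>MA x \<omega> - M_full P Y X x \<omega>\<bar>
      \<le> norm_K K (gcol k X x - gcol (k_agg P M Y \<epsilon>) X x) * norm_K K (obs Y X \<omega>)" (is ?abs)
    and "0 \<le> v_agg P M Y x - v_full P Y X x" (is ?nonneg)
    and "v_agg P M Y x \<le> expectation (\<lambda>\<omega>. (Y x \<omega> - M x \<omega> $ j)\<^sup>2)" (is ?sub)
proof -
  obtain c where c: "AE \<omega> in P. MA x \<omega> = c \<bullet> obs Y X \<omega>"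
    and kA: "gcol (k_agg P M Y \<epsilon>) X x = K *v c"
    and cc: "c \<bullet> (K *v c) = coef_agg x \<bullet> (Gram (M x) *v coef_agg x)"
    and cb: "c \<bullet> (K *v coef_full x) = c \<bullet> (K *v c)"
    using M_agg_linear[OF x] by blast
  define b where "b = coef_full x"
  have kX: "gcol k X x = K *v b"
    by (simp add: b_def K_coef_full)
  have kd: "gcol k X x - gcol (k_agg P M Y \<epsilon>) X x = K *v (b - c)"
    by (simp add: kX kA matrix_vector_mult_diff_distrib)
  note nK = norm_K_squared_mult[OF K_inv K_psd]
  note obs_inner = square_integrable_inner[OF obs_sq]
  have "expectation (\<lambda>\<omega>. (MA x \<omega> - M_full P Y X x \<omega>)\<^sup>2)
      = expectation (\<lambda>\<omega>. ((b - c) \<bullet> obs Y X \<omega>) * ((b - c) \<bullet> obs Y X \<omega>))"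
  proof (rule integral_cong_AE)
    show "AE \<omega> in P. (MA x \<omega> - M_full P Y X x \<omega>)\<^sup>2
        = ((b - c) \<bullet> obs Y X \<omega>) * ((b - c) \<bullet> obs Y X \<omega>)"
      using c by eventually_elim
        (simp add: M_full_eq[OF x] b_def inner_diff_left power2_eq_square algebra_simps)
    show "(\<lambda>\<omega>. (MA x \<omega> - M_full P Y X x \<omega>)\<^sup>2) \<in> borel_measurable P"
      using M_agg_sq[OF x] obs_inner[of b]
      by (auto simp: square_integrable_def M_full_eq[OF x] b_def)
    show "(\<lambda>\<omega>. ((b - c) \<bullet> obs Y X \<omega>) * ((b - c) \<bullet> obs Y X \<omega>)) \<in> borel_measurable P"
      using obs_inner[of "b - c"] by (auto simp: square_integrable_def)
  qed
  then show ?mse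
    by (simp only: kd nK expectation_inner_inner[OF obs_sq] K_eq_Gram[symmetric])
  \<comment> \<open>At the optimal weights the excess term of
    \<open>mean_square_error_linear\<close> is zero.\<close>
  have v_agg: "v_agg P M Y x = k x x - coef_agg x \<bullet> (Gram (M x) *v coef_agg x)"
    using mean_square_error_linear[OF M_sq[OF x] Y_sq[OF x] Gram_coef_agg[OF x], of "coef_agg x"]
    by (simp add: v_agg_def M_agg_eq[OF x] k_eq[OF x x] power2_eq_square)
  have v_full: "v_full P Y X x = k x x - b \<bullet> (K *v b)"
    by (simp add: v_full_def grow_k[OF x] kX matrix_inv_cancel K_inv inner_commute)
  show ?var
    by (simp only: kX kA nK v_agg v_full cc)
  \<comment> \<open>Pythagoras for the form \<open>K\<close>: by \<open>cb\<close>, the vector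
    \<open>c\<close> is orthogonal to \<open>b - c\<close>.\<close>
  have "(b - c) \<bullet> (K *v (b - c)) = b \<bullet> (K *v b) - c \<bullet> (K *v c)"
    using cb symmetric_matrix_inner[OF K_sym, of b c]
    by (simp add: b_def matrix_vector_mult_diff_distrib inner_diff_left inner_diff_right inner_commute)
  then show ?nonneg
    using K_psd[of "b - c"] by (simp add: v_agg v_full cc)
  show ?abs
    using c
  proof eventually_elim
    case (elim \<omega>)
    then have "\<bar>MA x \<omega> - M_full P Y X x \<omega>\<bar> = \<bar>(b - c) \<bullet> obs Y X \<omega>\<bar>"
      by (simp add: M_full_eq[OF x] b_def inner_diff_left)
    then show ?case
      using abs_inner_le_norm_K[OF K_inv K_sym K_psd, of "b - c" "obs Y X \<omega>"] by (simp add: kd)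
  qed
  \<comment> \<open>Submodel \<open>j\<close> is the linear predictor with weights
    \<open>axis j 1\<close>, and its excess error over the optimal weights is a value of the
    semidefinite form \<open>Gram (M x)\<close>.\<close>
  show ?sub
    using mean_square_error_linear[OF M_sq[OF x] Y_sq[OF x] Gram_coef_agg[OF x], of "axis j 1"]
      Gram_psd[OF M_sq[OF x], of "axis j 1 - coef_agg x"]
    by (simp add: v_agg k_eq[OF x x] power2_eq_square inner_axis')
qed

end

theorem proposition5:
  fixes P :: "'w measure"
    and D :: "(real ^ 'd) set"
    and M :: "real ^ 'd \<Rightarrow> 'w \<Rightarrow> real ^ 'p"
    and Y :: "real ^ 'd \<Rightarrow> 'w \<Rightarrow> real"
    and X :: "real ^ 'd ^ 'n"
    and \<epsilon> :: "real ^ 'd \<Rightarrow> 'w \<Rightarrow> real"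
  defines "k \<equiv> cov_kernel P Y"
    and "kA \<equiv> k_agg P M Y \<epsilon>"
    and "K \<equiv> gmat (cov_kernel P Y) X"
  assumes "prob_space P"
    and Y_rv: "\<forall>x\<in>D. Y x \<in> borel_measurable P"
    and Y_sq: "\<forall>x\<in>D. integrable P (\<lambda>\<omega>. (Y x \<omega>)\<^sup>2)"
    and Y_centered: "\<forall>x\<in>D. (\<integral>\<omega>. Y x \<omega> \<partial>P) = 0"
    and M_rv: "\<forall>x\<in>D. \<forall>i. (\<lambda>\<omega>. M x \<omega> $ i) \<in> borel_measurable P"
    and M_sq: "\<forall>x\<in>D. \<forall>i. integrable P (\<lambda>\<omega>. (M x \<omega> $ i)\<^sup>2)"
    and M_centered: "\<forall>x\<in>D. \<forall>i. (\<integral>\<omega>. M x \<omega> $ i \<partial>P) = 0"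
    and K_M_inv: "\<forall>x\<in>D. invertible (K_M P M x)"
    and X_in_D: "\<forall>i. X $ i \<in> D"
    and K_inv: "invertible K"
    and replicate: "independent_replicate P D M Y \<epsilon>"
    and linearity: "\<forall>x\<in>D. \<exists>\<Lambda> :: real ^ 'n ^ 'p. AE \<omega> in P. M x \<omega> = \<Lambda> *v obs Y X \<omega>"
    and interpolation: "\<forall>i. \<exists>j. AE \<omega> in P. M (X $ i) \<omega> $ j = Y (X $ i) \<omega>"
  shows
    "(\<forall>x\<in>D.
        (\<integral>\<omega>. (M_agg P M Y x \<omega> - M_full P Y X x \<omega>)\<^sup>2 \<partial>P)
          = (norm_K K (gcol k X x - gcol kA X x))\<^sup>2 \<and>
        v_agg P M Y x - v_full P Y X x
          = (norm_K K (gcol k X x))\<^sup>2 - (norm_K K (gcol kA X x))\<^sup>2 \<and>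
        (AE \<omega> in P. \<bar>M_agg P M Y x \<omega> - M_full P Y X x \<omega>\<bar>
          \<le> norm_K K (gcol k X x - gcol kA X x) * norm_K K (obs Y X \<omega>)) \<and>
        \<bar>v_agg P M Y x - v_full P Y X x\<bar> \<le> (norm_K K (gcol k X x))\<^sup>2 \<and>
        0 \<le> v_agg P M Y x - v_full P Y X x \<and>
        v_agg P M Y x - v_full P Y X x
          \<le> (MIN j. \<integral>\<omega>. (Y x \<omega> - M x \<omega> $ j)\<^sup>2 \<partial>P) - v_full P Y X x) \<and>
     (min_eigenvalue K \<noteq> 0 \<longrightarrow>
        (\<forall>u :: real ^ 'n. (norm_K K u)\<^sup>2 \<le> 1 / min_eigenvalue K * (norm u)\<^sup>2))"
proof -
  interpret prob_space P by fact
  interpret nk: nested_kriging P D M Y X \<epsilon>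
    using assms(5-) unfolding K_def by unfold_locales (auto simp: square_integrable_def)
  note err = nk.aggregation_error[folded K_def k_def kA_def]
  have min_le: "v_agg P M Y x \<le> (MIN j. \<integral>\<omega>. (Y x \<omega> - M x \<omega> $ j)\<^sup>2 \<partial>P)" if "x \<in> D" for x
    using err(5)[OF that] by (intro Min.boundedI) auto
  \<comment> \<open>The difference is nonnegative and equals the right side minus a square.\<close>
  have bound: "\<bar>v_agg P M Y x - v_full P Y X x\<bar> \<le> (norm_K K (gcol k X x))\<^sup>2" if "x \<in> D" for x
    using err(2,4)[OF that] by simp
  have "(norm_K K u)\<^sup>2 \<le> 1 / min_eigenvalue K * (norm u)\<^sup>2" if "min_eigenvalue K \<noteq> 0" for u
    using norm_K_le_norm[OF K_inv _ _ that] nk.K_sym nk.K_psd by (simp add: K_def)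
  moreover note err(1-4) min_le bound
  ultimately show ?thesis
    by (intro conjI ballI impI allI diff_right_mono)
qed

end
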